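(* Let $X$ and $Y$ be two Hermitian operators on a $d$-dimensional complex Hilbert space, and let $\Lambda(X)$ and $\Lambda(Y)$ denote their sets of eigenvalues. Let $x_1<x_2<\dots<x_n$ and $y_1<y_2<\dots<y_m$ be finite increasing sequences of real numbers ($n,m\ge 2$) such that $\Lambda(X)\subset\{x_1,\dots,x_n\}$ and $\Lambda(Y)\subset\{y_1,\dots,y_m\}$. For $1\le i\le n-1$ and $1\le j\le m-1$ put $$X_i=X^2-(x_i+x_{i+1})X+x_ix_{i+1}\mathbb{1},\qquad Y_j=Y^2-(y_j+y_{j+1})Y+y_jy_{j+1}\mathbb{1}.$$ Then for every density matrix $\rho\in\mathcal{M}_d$, $$\Delta^2X_\rho+\Delta^2Y_\rho\ \ge\ \min_{i,j}\lambda_{\min}(X_i+Y_j).$$ Moreover the error of this bound is controlled: $$\min_{\rho\in\mathcal{M}_d}\left(\Delta^2X_\rho+\Delta^2Y_\rho\right)-\min_{i,j}\lambda_{\min}(X_i+Y_j)\ \le\ \delta_X+\delta_Y,$$ where $$\delta_X=\left(\frac{\max_{1\le i\le n-1}(x_{i+1}-x_i)}{2}\right)^2,\qquad \delta_Y=\left(\frac{\max_{1\le j\le m-1}(y_{j+1}-y_j)}{2}\right)^2.$$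
   Context: $\mathcal{M}_d=\{\rho:\rho^\dagger=\rho\ge 0,\ \mathrm{Tr}\,\rho=1\}$ is the set of density matrices (mixed states) of size $d$. For a Hermitian operator $F$ and $\rho\in\mathcal{M}_d$, $\langle F\rangle_\rho=\mathrm{Tr}(\rho F)$, and the variance is $\Delta^2F_\rho=\langle F^2\rangle_\rho-\langle F\rangle_\rho^2$. $\lambda_{\min}(F)$ denotes the smallest eigenvalue of $F$, and $\mathbb{1}$ is the identity operator. *)

theory Defs
  imports
    "Jordan_Normal_Form.Spectral_Radius"
    "Jordan_Normal_Form.Schur_Decomposition"
begin

definition hermitian_mat :: "nat \<Rightarrow> complex mat \<Rightarrow> bool" where
  "hermitian_mat d A \<longleftrightarrow> A \<in> carrier_mat d d \<and> mat_adjoint A = A"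

(* The order on complex numbers is the one of Complex_Order:
   0 \<le> z means that z is real and nonnegative. *)
definition psd_mat :: "nat \<Rightarrow> complex mat \<Rightarrow> bool" where
  "psd_mat d A \<longleftrightarrow>
     hermitian_mat d A \<and> (\<forall>v\<in>carrier_vec d. 0 \<le> (A *\<^sub>v v) \<bullet>c v)"

definition mat_trace :: "complex mat \<Rightarrow> complex" where
  "mat_trace A = (\<Sum>i<dim_row A. A $$ (i, i))"

definition density_matrices :: "nat \<Rightarrow> complex mat set" where
  "density_matrices d = {\<rho>. psd_mat d \<rho> \<and> mat_trace \<rho> = 1}"

(* Tr (\<rho> F) is a real number when \<rho> and F are Hermitian, so taking the real part
   only changes the type. *)
definition expectation_val :: "complex mat \<Rightarrow> complex mat \<Rightarrow> real" where
  "expectation_val \<rho> F = Re (mat_trace (\<rho> * F))"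

definition variance_val :: "complex mat \<Rightarrow> complex mat \<Rightarrow> real" where
  "variance_val \<rho> F = expectation_val \<rho> (F ^\<^sub>m 2) - (expectation_val \<rho> F)\<^sup>2"

(* Meant for Hermitian F of positive size, where every eigenvalue is real and the
   set below is finite and nonempty. *)
definition lambda_min :: "complex mat \<Rightarrow> real" where
  "lambda_min F = Min {a. complex_of_real a \<in> spectrum F}"

definition shifted_square :: "complex mat \<Rightarrow> real \<Rightarrow> real \<Rightarrow> complex mat" where
  "shifted_square X a b =
     X ^\<^sub>m 2 - complex_of_real (a + b) \<cdot>\<^sub>m X
       + complex_of_real (a * b) \<cdot>\<^sub>m 1\<^sub>m (dim_row X)"

(* The levels of a sequence are x 1, ..., x n; other values of x are irrelevant. *)
definition spectral_bound ::
  "complex mat \<Rightarrow> (nat \<Rightarrow> real) \<Rightarrow> nat \<Rightarrow> complex mat \<Rightarrow> (nat \<Rightarrow> real) \<Rightarrow> nat \<Rightarrow> real" where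
  "spectral_bound X x n Y y m =
     Min {lambda_min (shifted_square X (x i) (x (i + 1)) + shifted_square Y (y j) (y (j + 1))) | i j.
            i \<in> {1..n - 1} \<and> j \<in> {1..m - 1}}"

definition gap_error :: "(nat \<Rightarrow> real) \<Rightarrow> nat \<Rightarrow> real" where
  "gap_error x n = (Max ((\<lambda>i. x (i + 1) - x i) ` {1..n - 1}) / 2)\<^sup>2"

end

theory Submission
  imports Defs "HOL-Analysis.Convex_Euclidean_Space"
begin

text \<open>
  Adding \<open>(\<langle>X\<rangle> - a) (\<langle>X\<rangle> - b)\<close> to the variance of \<open>X\<close> gives the expectation of
  \<open>(X - a) (X - b)\<close>. If \<open>a\<close>, \<open>b\<close> are consecutive levels around \<open>\<langle>X\<rangle>\<close>, the added term is
  nonpositive, which gives the lower bound; it is always at least \<open>- ((b - a) / 2)\<^sup>2\<close>, so a pure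
  ground state of the best \<open>X\<^sub>i + Y\<^sub>j\<close> gives the error estimate.

  The minimum over the states exists because it equals the minimum over real \<open>a\<close>, \<open>b\<close> in a compact
  box of \<open>h (a, b) = \<lambda>\<^sub>m\<^sub>i\<^sub>n ((X - a)\<^sup>2 + (Y - b)\<^sup>2)\<close>: the function \<open>a\<^sup>2 + b\<^sup>2 - h (a, b)\<close> is a maximum of
  affine functions, hence convex and continuous. No topology on matrices is needed.

  The variational principle for \<open>\<lambda>\<^sub>m\<^sub>i\<^sub>n\<close> avoids the spectral theorem. A state is a sum of rank-one
  matrices by Cholesky elimination. For the infimum \<open>l\<close> of the Rayleigh quotient, \<open>A - l\<close> is positive
  semidefinite; if it were invertible, the Cauchy-Schwarz inequality for its form would bound it below
  by a positive multiple of the identity, contradicting the choice of \<open>l\<close>.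
\<close>

section \<open>Sesquilinear forms of complex kernels\<close>

text \<open>The form is linear in \<open>v\<close> and conjugate-linear in \<open>w\<close>. Plain
  functions replace matrices and vectors, so combinations and eliminations carry no dimension
  conditions; only indices below \<open>d\<close> count.\<close>

definition qform ::
  "nat \<Rightarrow> (nat \<Rightarrow> nat \<Rightarrow> complex) \<Rightarrow> (nat \<Rightarrow> complex) \<Rightarrow> (nat \<Rightarrow> complex) \<Rightarrow> complex" where
  "qform d a v w = (\<Sum>i<d. \<Sum>j<d. a i j * v j * cnj (w i))"

definition psd_kernel :: "nat \<Rightarrow> (nat \<Rightarrow> nat \<Rightarrow> complex) \<Rightarrow> bool" where
  "psd_kernel d a \<longleftrightarrow>
     (\<forall>i<d. \<forall>j<d. a j i = cnj (a i j)) \<and> (\<forall>v. 0 \<le> Re (qform d a v v))"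

lemma qform_add_smult_left:
  "qform d a (\<lambda>i. v i + t * w i) u = qform d a v u + t * qform d a w u"
  by (simp add: qform_def algebra_simps sum.distrib sum_distrib_left)

lemma qform_add_smult_right:
  "qform d a u (\<lambda>i. v i + t * w i) = qform d a u v + cnj t * qform d a u w"
  by (simp add: qform_def distrib_left sum.distrib sum_distrib_left mult_ac)

lemma qform_smult: "qform d a (\<lambda>i. t * v i) (\<lambda>i. t * v i) = of_real ((cmod t)\<^sup>2) * qform d a v v"
  unfolding complex_norm_square by (simp add: qform_def sum_distrib_left mult_ac)

lemma qform_diff_kernel: "qform d (\<lambda>i j. a i j - b i j) v w = qform d a v w - qform d b v w"
  by (simp add: qform_def algebra_simps sum_subtractf)

lemma qform_rank_one:
  "qform d (\<lambda>i j. u i * cnj (u j)) v v = of_real ((cmod (\<Sum>i<d. v i * cnj (u i)))\<^sup>2)"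
  unfolding complex_norm_square qform_def cnj_sum sum_product
  by (subst sum.swap) (simp add: mult_ac)

lemma qform_hermitian:
  assumes "\<And>i j. i < d \<Longrightarrow> j < d \<Longrightarrow> a j i = cnj (a i j)"
  shows "qform d a w v = cnj (qform d a v w)"
proof -
  have "cnj (qform d a v w) = (\<Sum>i<d. \<Sum>j<d. a j i * cnj (v j) * w i)"
    unfolding qform_def cnj_sum
    by (intro sum.cong refl) (metis assms complex_cnj_cnj complex_cnj_mult lessThan_iff)
  also have "\<dots> = qform d a w v"
    unfolding qform_def by (subst sum.swap) (simp add: mult_ac)
  finally show ?thesis by simp
qed

lemma qform_unit_right:
  assumes "k < d" shows "qform d a v (\<lambda>i. if i = k then 1 else 0) = (\<Sum>j<d. a k j * v j)"
proof -
  have "qform d a v (\<lambda>i. if i = k then 1 else 0) = (\<Sum>i<d. if i = k then (\<Sum>j<d. a k j * v j) else 0)"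
    unfolding qform_def by (intro sum.cong refl) auto
  then show ?thesis using assms by simp
qed

lemma qform_unit:
  assumes "k < d" "l < d"
  shows "qform d a (\<lambda>i. if i = l then 1 else 0) (\<lambda>i. if i = k then 1 else 0) = a k l"
proof -
  have "(\<Sum>j<d. a k j * (if j = l then 1 else 0)) = (\<Sum>j<d. if j = l then a k l else 0)"
    by (intro sum.cong refl) auto
  then show ?thesis using assms by (simp add: qform_unit_right)
qed

text \<open>Nonnegativity of the form at \<open>v + t * w\<close> yields a real quadratic inequality
  in the size of \<open>t\<close>. The form is only semidefinite, so a vanishing value at
  \<open>w\<close> is treated separately.\<close>

lemma psd_kernel_Cauchy_Schwarz:
  assumes "psd_kernel d a"
  shows "(cmod (qform d a v w))\<^sup>2 \<le> Re (qform d a v v) * Re (qform d a w w)"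
proof -
  define \<beta> where "\<beta> = qform d a v w"
  define p where "p = Re (qform d a v v)"
  define c where "c = Re (qform d a w w)"
  define B where "B = (cmod \<beta>)\<^sup>2"
  have wv: "qform d a w v = cnj \<beta>"
    unfolding \<beta>_def by (rule qform_hermitian) (use assms in \<open>unfold psd_kernel_def, blast\<close>)
  have nonneg: "0 \<le> p" "0 \<le> c" "0 \<le> B"
    using assms by (simp_all add: psd_kernel_def p_def c_def B_def)
  have ineq: "0 \<le> p - 2 * s * B + s\<^sup>2 * B * c" for s :: real
  proof -
    \<comment> \<open>The phase of \<open>t\<close> is opposite to that of \<beta> for positive
      \<open>s\<close>, so both cross terms are real and add up to
      \<open>- 2 * s * B\<close>.\<close>
    define t where "t = - (complex_of_real s * \<beta>)"
    have bb: "Re \<beta> * Re \<beta> + Im \<beta> * Im \<beta> = B"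
      unfolding B_def cmod_power2 by (simp add: power2_eq_square)
    have "qform d a (\<lambda>i. v i + t * w i) (\<lambda>i. v i + t * w i)
        = qform d a v v + cnj t * \<beta> + t * cnj \<beta> + (t * cnj t) * qform d a w w"
      unfolding qform_add_smult_left qform_add_smult_right wv \<beta>_def[symmetric]
      by (simp add: algebra_simps)
    moreover have "t * cnj t = of_real (s\<^sup>2 * B)"
      unfolding complex_norm_square[symmetric]
      by (simp add: t_def B_def norm_mult power_mult_distrib)
    moreover have "cnj t * \<beta> + t * cnj \<beta> = of_real (- 2 * s * B)"
      by (simp add: t_def complex_eq_iff bb[symmetric] algebra_simps)
    ultimately have "qform d a (\<lambda>i. v i + t * w i) (\<lambda>i. v i + t * w i)
        = qform d a v v + of_real (- 2 * s * B) + of_real (s\<^sup>2 * B) * qform d a w w"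
      by (metis (no_types, lifting) add.assoc)
    then have "Re (qform d a (\<lambda>i. v i + t * w i) (\<lambda>i. v i + t * w i)) = p - 2 * s * B + s\<^sup>2 * B * c"
      by (simp add: p_def c_def)
    then show ?thesis using assms unfolding psd_kernel_def by metis
  qed
  have "B \<le> p * c"
  proof (cases "c = 0")
    case True
    show ?thesis
    proof (rule ccontr)
      assume "\<not> B \<le> p * c"
      then have "B > 0" using True by simp
      \<comment> \<open>For \<open>c = 0\<close> the polynomial is linear in \<open>s\<close>, and
        this \<open>s\<close> gives it the value -1.\<close>
      then show False using ineq[of "(p + 1) / (2 * B)"] True by simp
    qed
  next
    case False
    then have "c > 0" using nonneg by simp
    \<comment> \<open>The choice \<open>s = 1 / c\<close> minimises the quadratic and leaves
      \<open>p - B / c\<close>.\<close>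
    then show ?thesis using ineq[of "1 / c"] by (simp add: field_simps power2_eq_square)
  qed
  then show ?thesis by (simp add: B_def p_def c_def \<beta>_def)
qed

section \<open>Gram decomposition by Cholesky elimination\<close>

text \<open>Each elimination step subtracts the rank-one kernel of the pivot column, scaled by the
  root of the pivot. The residue \<open>b\<close> stays positive semidefinite and gains one more
  zero row.\<close>

lemma psd_kernel_Gram_partial:
  assumes "psd_kernel d a" "k \<le> d"
  shows "\<exists>b u. psd_kernel d b \<and> (\<forall>i<d. \<forall>j<d. i < k \<longrightarrow> b i j = 0) \<and>
     (\<forall>i<d. \<forall>j<d. a i j = b i j + (\<Sum>l<k. u l i * cnj (u l j)))"
  using assms(2)
proof (induction k)
  case 0
  show ?case using assms(1) by (intro exI[of _ a]) simp
next
  case (Suc k)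
  then have k: "k < d" by simp
  from Suc obtain b u where b: "psd_kernel d b"
    and zero: "\<And>i j. i < d \<Longrightarrow> j < d \<Longrightarrow> i < k \<Longrightarrow> b i j = 0"
    and dec: "\<And>i j. i < d \<Longrightarrow> j < d \<Longrightarrow> a i j = b i j + (\<Sum>l<k. u l i * cnj (u l j))"
    by auto
  have herm: "b j i = cnj (b i j)" if "i < d" "j < d" for i j
    using b that unfolding psd_kernel_def by blast
  define c where "c = Re (b k k)"
  define e where "e = (\<lambda>k i :: nat. if i = k then 1 else 0 :: complex)"
  have bkk: "b k k = of_real c"
    using arg_cong[OF herm[OF k k], of Im] by (simp add: c_def complex_eq_iff)
  have "0 \<le> Re (qform d b (e k) (e k))" using b by (simp add: psd_kernel_def)
  then have c0: "c \<ge> 0" unfolding e_def qform_unit[OF k k] c_def .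
  \<comment> \<open>If the pivot \<open>c\<close> is 0, division by zero makes \<open>w\<close>
    vanish and nothing is subtracted. This is right: row \<open>k\<close> of \<open>b\<close> is
    then already zero by Cauchy-Schwarz.\<close>
  define w where "w i = b i k / of_real (sqrt c)" for i
  define b' where "b' = (\<lambda>i j. b i j - w i * cnj (w j))"
  have row0: "b' k j = 0" if j: "j < d" for j
  proof (cases "c = 0")
    case True
    have "(cmod (qform d b (e j) (e k)))\<^sup>2 \<le> Re (qform d b (e j) (e j)) * Re (qform d b (e k) (e k))"
      by (rule psd_kernel_Cauchy_Schwarz[OF b])
    then have "b k j = 0" using True by (simp add: e_def qform_unit k j bkk)
    then show ?thesis using True by (simp add: b'_def w_def)
  next
    case False
    then have "of_real (sqrt c) * of_real (sqrt c) = (of_real c :: complex)"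
      using c0 by (metis of_real_mult real_sqrt_mult_self abs_of_nonneg)
    then show ?thesis using False c0 herm[OF j k]
      by (simp add: b'_def w_def bkk field_simps)
  qed
  have "psd_kernel d b'"
    unfolding psd_kernel_def
  proof (intro conjI allI impI)
    fix i j assume "i < d" "j < d"
    then show "b' j i = cnj (b' i j)"
      unfolding b'_def by (simp only: herm[of i j] complex_cnj_diff complex_cnj_mult complex_cnj_cnj mult_ac)
  next
    fix v
    have qf: "qform d b' v v = qform d b v v - of_real ((cmod (\<Sum>i<d. v i * cnj (w i)))\<^sup>2)"
      unfolding b'_def qform_diff_kernel qform_rank_one ..
    \<comment> \<open>The subtracted amount is the squared modulus of the form at \<open>v\<close>
      and \<open>e k\<close>, divided by \<open>c\<close>. Cauchy-Schwarz bounds it by the form at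
      \<open>v\<close>, so the Schur complement stays nonnegative.\<close>
    have "(\<Sum>i<d. v i * cnj (w i)) = (\<Sum>i<d. b k i * v i) / of_real (sqrt c)"
      unfolding sum_divide_distrib w_def
      by (intro sum.cong refl) (use k in \<open>simp add: mult_ac herm[OF k]\<close>)
    also have "\<dots> = qform d b v (e k) / of_real (sqrt c)"
      by (simp add: e_def qform_unit_right k)
    finally have "(cmod (\<Sum>i<d. v i * cnj (w i)))\<^sup>2 = (cmod (qform d b v (e k)))\<^sup>2 / c"
      using c0 by (simp add: norm_divide power_divide)
    also have "\<dots> \<le> Re (qform d b v v) * c / c"
      using psd_kernel_Cauchy_Schwarz[OF b, of v "e k"] c0
      by (intro divide_right_mono) (simp_all add: e_def qform_unit k bkk)
    also have "\<dots> \<le> Re (qform d b v v)"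
      using b by (cases "c = 0") (simp_all add: psd_kernel_def)
    finally show "0 \<le> Re (qform d b' v v)" by (simp add: qf)
  qed
  moreover have "b' i j = 0" if "i < d" "j < d" "i < Suc k" for i j
  proof (cases "i = k")
    case False
    then have "i < k" using that by simp
    \<comment> \<open>Rows cleared earlier stay zero, because \<open>b i k = 0\<close> makes
      \<open>w i\<close> vanish.\<close>
    then show ?thesis using that zero[of i j] zero[of i k] k by (simp add: b'_def w_def)
  qed (use row0 that in simp)
  moreover have "a i j = b' i j + (\<Sum>l<Suc k. (u(k := w)) l i * cnj ((u(k := w)) l j))"
    if "i < d" "j < d" for i j
    using dec[OF that] by (simp add: b'_def)
  ultimately show ?case by blast
qed

lemma psd_kernel_Gram:
  assumes "psd_kernel d a"
  obtains u where "\<forall>i<d. \<forall>j<d. a i j = (\<Sum>l<d. u l i * cnj (u l j))"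
proof -
  obtain b u where "\<And>i j. i < d \<Longrightarrow> j < d \<Longrightarrow> b i j = 0"
    and "\<And>i j. i < d \<Longrightarrow> j < d \<Longrightarrow> a i j = b i j + (\<Sum>l<d. u l i * cnj (u l j))"
    using psd_kernel_Gram_partial[OF assms order_refl] by blast
  then show thesis by (intro that[of u]) simp
qed

section \<open>From matrices to kernels\<close>

abbreviation entries :: "complex mat \<Rightarrow> nat \<Rightarrow> nat \<Rightarrow> complex" where
  "entries A \<equiv> \<lambda>i j. A $$ (i, j)"

lemma qform_eq_cscalar_prod:
  assumes "A \<in> carrier_mat d d" "v \<in> carrier_vec d" "w \<in> carrier_vec d"
  shows "qform d (entries A) (vec_index v) (vec_index w) = (A *\<^sub>v v) \<bullet>c w"
  using assms
  by (auto simp: qform_def scalar_prod_def sum_distrib_right atLeast0LessThan intro!: sum.cong)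

lemma qform_vec: "qform d a (vec_index (Matrix.vec d v)) (vec_index (Matrix.vec d w)) = qform d a v w"
  by (simp add: qform_def)

lemma hermitian_mat_iff:
  "hermitian_mat d A \<longleftrightarrow>
     A \<in> carrier_mat d d \<and> (\<forall>i<d. \<forall>j<d. A $$ (j, i) = cnj (A $$ (i, j)))"
proof (cases "A \<in> carrier_mat d d")
  case True
  have dims: "dim_row (mat_adjoint A) = d" "dim_col (mat_adjoint A) = d"
    using True by (simp_all add: mat_adjoint_def)
  have "mat_adjoint A $$ (j, i) = cnj (A $$ (i, j))" if "i < d" "j < d" for i j
    using True that by (simp add: mat_adjoint_def mat_of_rows_index)
  then have "mat_adjoint A = A \<longleftrightarrow> (\<forall>j<d. \<forall>i<d. cnj (A $$ (i, j)) = A $$ (j, i))"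
    using True dims by (simp add: mat_eq_iff)
  then show ?thesis using True unfolding hermitian_mat_def by metis
qed (simp add: hermitian_mat_def)

lemma psd_mat_imp_psd_kernel:
  assumes "psd_mat d A"
  shows "psd_kernel d (entries A)"
  unfolding psd_kernel_def
proof (intro conjI allI)
  fix v
  have "A \<in> carrier_mat d d" using assms by (simp add: psd_mat_def hermitian_mat_def)
  then have "qform d (entries A) v v = (A *\<^sub>v Matrix.vec d v) \<bullet>c Matrix.vec d v"
    by (simp add: qform_eq_cscalar_prod[symmetric] qform_vec)
  then show "0 \<le> Re (qform d (entries A) v v)"
    using assms by (simp add: psd_mat_def less_eq_complex_def)
qed (use assms in \<open>unfold psd_mat_def hermitian_mat_iff, blast\<close>)

lemma qform_cong:
  assumes "\<And>i j. i < d \<Longrightarrow> j < d \<Longrightarrow> a i j = b i j"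
    and "\<And>i. i < d \<Longrightarrow> v i = v' i" "\<And>i. i < d \<Longrightarrow> w i = w' i"
  shows "qform d a v w = qform d b v' w'"
  using assms by (simp add: qform_def)

text \<open>A crude bound, serving twice: it bounds the Rayleigh quotient from below on unit vectors
  and bounds the form of an inverse matrix.\<close>

lemma cmod_qform_le:
  assumes "\<And>i. i < d \<Longrightarrow> cmod (v i) \<le> 1" "\<And>i. i < d \<Longrightarrow> cmod (w i) \<le> 1"
  shows "cmod (qform d a v w) \<le> (\<Sum>i<d. \<Sum>j<d. cmod (a i j))"
  unfolding qform_def
proof (intro sum_norm_le)
  fix i j assume "i \<in> {..<d}" "j \<in> {..<d}"
  then have "cmod (a i j) * cmod (v j) * cmod (w i) \<le> cmod (a i j) * 1 * 1"
    using assms by (intro mult_mono) auto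
  then show "cmod (a i j * v j * cnj (w i)) \<le> cmod (a i j)"
    by (simp add: norm_mult)
qed

lemma cscalar_prod_self:
  "v \<in> carrier_vec d \<Longrightarrow> v \<bullet>c v = of_real (\<Sum>i<d. (cmod (vec_index v i))\<^sup>2)"
  unfolding of_real_sum complex_norm_square
  by (auto simp: scalar_prod_def atLeast0LessThan intro!: sum.cong)

lemma entry_le_1_of_unit:
  fixes v :: "nat \<Rightarrow> complex"
  assumes "(\<Sum>i<d. (cmod (v i))\<^sup>2) = 1" "i < d"
  shows "cmod (v i) \<le> 1"
proof -
  have "(cmod (v i))\<^sup>2 \<le> (\<Sum>i<d. (cmod (v i))\<^sup>2)"
    using assms(2) by (intro member_le_sum) auto
  then show ?thesis using assms(1) by (simp add: power_le_one_iff)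
qed

section \<open>The variational principle for the least eigenvalue\<close>

lemma hermitian_Rayleigh_minimum:
  assumes A: "hermitian_mat d A" and d: "d \<ge> 1"
  obtains l where "complex_of_real l \<in> spectrum A"
    and "\<forall>v. l * (\<Sum>i<d. (cmod (v i))\<^sup>2) \<le> Re (qform d (entries A) v v)"
proof -
  let ?n = "\<lambda>v :: nat \<Rightarrow> complex. \<Sum>i<d. (cmod (v i))\<^sup>2"
  let ?q = "\<lambda>v. Re (qform d (entries A) v v)"
  have cA: "A \<in> carrier_mat d d"
    using A by (simp add: hermitian_mat_def)
  have herm: "A $$ (j, i) = cnj (A $$ (i, j))" if "i < d" "j < d" for i j
    using A that unfolding hermitian_mat_iff by blast
  define S where "S = {?q v | v. ?n v = 1}"
  define l where "l = Inf S"
  \<comment> \<open>A unit vector, available since \<open>d\<close> is positive; it makes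
    \<open>S\<close> nonempty.\<close>
  define e :: "nat \<Rightarrow> complex" where "e i = (if i = 0 then 1 else 0)" for i
  have "?n e = (\<Sum>i<d. if i = 0 then 1 else 0)"
    by (intro sum.cong) (auto simp: e_def)
  then have e: "?n e = 1" using d by simp
  have S_I: "?q v \<in> S" if "?n v = 1" for v
    unfolding S_def using that by (intro CollectI exI[of _ v] conjI refl)
  have S_E: "\<exists>v. s = ?q v \<and> ?n v = 1" if "s \<in> S" for s
    using that unfolding S_def by (rule CollectD)
  have "bdd_below S"
  proof (rule bdd_belowI)
    fix s assume "s \<in> S"
    then obtain v where s: "s = ?q v" and v: "?n v = 1"
      using S_E by blast
    have "cmod (qform d (entries A) v v) \<le> (\<Sum>i<d. \<Sum>j<d. cmod (A $$ (i, j)))"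
      by (intro cmod_qform_le entry_le_1_of_unit[OF v])
    then show "- (\<Sum>i<d. \<Sum>j<d. cmod (A $$ (i, j))) \<le> s"
      using abs_Re_le_cmod[of "qform d (entries A) v v"] s by linarith
  qed
  then have lower: "l \<le> ?q v" if "?n v = 1" for v
    unfolding l_def by (rule cInf_lower[OF S_I[OF that]])
  have bound: "l * ?n v \<le> ?q v" for v
  proof (cases "?n v = 0")
    case True
    then have "\<forall>i\<in>{..<d}. (cmod (v i))\<^sup>2 = 0"
      using sum_nonneg_eq_0_iff[of "{..<d}" "\<lambda>i. (cmod (v i))\<^sup>2"] by simp
    then have "qform d (entries A) v v = 0" by (simp add: qform_def)
    then show ?thesis using True by simp
  next
    case False
    moreover have "?n v \<ge> 0" by (intro sum_nonneg) simp
    ultimately have pos: "?n v > 0" by linarith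
    define t where "t = complex_of_real (1 / sqrt (?n v))"
    have t: "(cmod t)\<^sup>2 = 1 / ?n v"
      using pos by (simp add: t_def norm_divide power_divide)
    have "?n (\<lambda>i. t * v i) = (cmod t)\<^sup>2 * ?n v"
      by (simp add: norm_mult power_mult_distrib sum_distrib_left)
    then have "l \<le> ?q (\<lambda>i. t * v i)" using pos t by (intro lower) simp
    also have "\<dots> = ?q v / ?n v" by (simp add: qform_smult t)
    finally show ?thesis using pos by (simp add: field_simps)
  qed
  \<comment> \<open>This is \<open>A\<close> minus \<open>l\<close> times the identity; its form is
    nonnegative by \<open>bound\<close>.\<close>
  define C where "C = char_matrix A (of_real l)"
  have cC: "C \<in> carrier_mat d d" using cA by (simp add: C_def char_matrix_def)
  have C: "C $$ (i, j) = A $$ (i, j) - of_real l * (if i = j then 1 else 0)"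
    if "i < d" "j < d" for i j
    using that cA by (simp add: C_def char_matrix_def)
  have qC: "qform d (entries C) v v = qform d (entries A) v v - of_real (l * ?n v)" for v
  proof -
    have "qform d (\<lambda>i j. of_real l * (if i = j then 1 else 0)) v v
        = (\<Sum>i<d. \<Sum>j<d. if i = j then of_real l * v i * cnj (v i) else 0)"
      unfolding qform_def by (intro sum.cong) auto
    also have "\<dots> = of_real (l * ?n v)"
      unfolding of_real_mult of_real_sum complex_norm_square
      by (simp add: sum_distrib_left mult_ac)
    moreover have "qform d (entries C) v v
        = qform d (\<lambda>i j. A $$ (i, j) - of_real l * (if i = j then 1 else 0)) v v"
      by (rule qform_cong[OF C refl refl])
    ultimately show ?thesis unfolding qform_diff_kernel by simp
  qed
  have psd: "psd_kernel d (entries C)"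
    unfolding psd_kernel_def
  proof (intro conjI allI impI)
    fix i j assume ij: "i < d" "j < d"
    show "C $$ (j, i) = cnj (C $$ (i, j))"
      unfolding C[OF ij] C[OF ij(2,1)] herm[OF ij] by simp
  qed (use bound in \<open>simp add: qC\<close>)
  have "eigenvalue A (of_real l)"
  proof (rule ccontr)
    assume "\<not> eigenvalue A (of_real l)"
    then have "det C \<noteq> 0" unfolding eigenvalue_det[OF cA] C_def .
    then have "C \<in> Units (ring_mat TYPE(complex) d ())"
      by (rule det_non_zero_imp_unit[OF cC])
    then obtain B where cB: "B \<in> carrier_mat d d" and CB: "C * B = 1\<^sub>m d"
      by (auto simp: Units_def ring_mat_def)
    define K where "K = (\<Sum>i<d. \<Sum>j<d. cmod (B $$ (i, j)))"
    have K: "K \<ge> 0" unfolding K_def by (intro sum_nonneg) simp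
    \<comment> \<open>For \<open>u\<close> with \<open>C u = v\<close>, the form of \<open>C\<close>
      at \<open>u\<close> and \<open>v\<close> equals 1. By Cauchy-Schwarz, 1 is at most the product
      of its values at \<open>u\<close> and at \<open>v\<close>. The value at \<open>u\<close> is
      the conjugate of the form of \<open>B\<close> at \<open>v\<close>, so \<open>K\<close> bounds
      its real part. Using \<open>K + 1\<close> keeps the divisor positive.\<close>
    have gap: "l + 1 / (K + 1) \<le> ?q v" if v: "?n v = 1" for v
    proof -
      define w where "w = Matrix.vec d v"
      define u where "u = B *\<^sub>v w"
      have cw: "w \<in> carrier_vec d" by (simp add: w_def)
      have cu: "u \<in> carrier_vec d"
        unfolding u_def by (rule mult_mat_vec_carrier[OF cB cw])
      have Cu: "C *\<^sub>v u = w"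
        using cw by (simp add: u_def assoc_mult_mat_vec[OF cC cB cw, symmetric] CB)
      have wv: "qform d a x (vec_index w) = qform d a x v"
               "qform d a (vec_index w) x = qform d a v x" for a x
        by (simp_all add: qform_def w_def)
      have "qform d (entries C) (vec_index u) v = w \<bullet>c w"
        using qform_eq_cscalar_prod[OF cC cu cw] by (simp add: wv Cu)
      also have "\<dots> = of_real (?n v)" by (simp add: cscalar_prod_self[OF cw]) (simp add: w_def)
      finally have "1 \<le> Re (qform d (entries C) (vec_index u) (vec_index u)) * Re (qform d (entries C) v v)"
        using psd_kernel_Cauchy_Schwarz[OF psd, of "vec_index u" v] v by simp
      also have "\<dots> \<le> (K + 1) * Re (qform d (entries C) v v)"
      proof (intro mult_right_mono)
        have "qform d (entries C) (vec_index u) (vec_index u) = w \<bullet>c u"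
          by (simp add: qform_eq_cscalar_prod[OF cC cu cu] Cu)
        also have "\<dots> = cnj (u \<bullet>c w)"
          using conjugate_vec_sprod_comm[OF cw cu] conjugate_conjugate_sprod[OF cu cw]
          by (metis complex_cnj_cnj conjugate_complex_def)
        also have "u \<bullet>c w = qform d (entries B) v v"
          using qform_eq_cscalar_prod[OF cB cw cw] by (simp add: wv u_def)
        finally have "Re (qform d (entries C) (vec_index u) (vec_index u)) \<le> cmod (qform d (entries B) v v)"
          by (metis complex_Re_le_cmod complex_mod_cnj)
        also have "\<dots> \<le> K"
          unfolding K_def by (intro cmod_qform_le entry_le_1_of_unit[OF v])
        finally show "Re (qform d (entries C) (vec_index u) (vec_index u)) \<le> K + 1" by simp
      qed (use psd in \<open>simp add: psd_kernel_def\<close>)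
      also have "Re (qform d (entries C) v v) = ?q v - l" using v by (simp add: qC)
      finally show ?thesis using K by (simp add: field_simps)
    qed
    have "l + 1 / (K + 1) \<le> Inf S"
      using S_I[OF e] gap by (intro cInf_greatest) (use S_E in fastforce)+
    moreover have "1 / (K + 1) > 0" using K by simp
    ultimately show False unfolding l_def by linarith
  qed
  then show thesis using bound by (intro that[of l]) (simp_all add: spectrum_def)
qed

text \<open>Normalising an eigenvector turns the eigenvalue into a value of the Rayleigh
  quotient.\<close>

lemma spectrum_eigenvectorE:
  assumes A: "A \<in> carrier_mat d d" and "k \<in> spectrum A"
  obtains v where "(\<Sum>i<d. (cmod (v i))\<^sup>2) = 1" "qform d (entries A) v v = k"
proof -
  from assms obtain w where w: "w \<in> carrier_vec d" "w \<noteq> 0\<^sub>v d" "A *\<^sub>v w = k \<cdot>\<^sub>v w"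
    by (auto simp: spectrum_def eigenvalue_def eigenvector_def)
  define N where "N = (\<Sum>i<d. (cmod (vec_index w i))\<^sup>2)"
  have q: "qform d (entries A) (vec_index w) (vec_index w) = k * of_real N"
    using w by (simp add: qform_eq_cscalar_prod[OF A] cscalar_prod_self N_def)
  obtain i where "i < d" "vec_index w i \<noteq> 0"
    using w by (metis carrier_vecD eq_vecI index_zero_vec(1) index_zero_vec(2))
  then have N: "N > 0" unfolding N_def by (intro sum_pos2[of _ i]) auto
  define t where "t = complex_of_real (1 / sqrt N)"
  have t: "(cmod t)\<^sup>2 = 1 / N"
    using N by (simp add: t_def norm_divide power_divide)
  show thesis
  proof (rule that[of "\<lambda>i. t * vec_index w i"])
    have "(\<Sum>i<d. (cmod (t * vec_index w i))\<^sup>2) = (cmod t)\<^sup>2 * N"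
      by (simp add: N_def norm_mult power_mult_distrib sum_distrib_left)
    then show "(\<Sum>i<d. (cmod (t * vec_index w i))\<^sup>2) = 1" using t N by simp
    show "qform d (entries A) (\<lambda>i. t * vec_index w i) (\<lambda>i. t * vec_index w i) = k"
      unfolding qform_smult q t using N by simp
  qed
qed

text \<open>The Rayleigh infimum is an eigenvalue, and every real eigenvalue is a Rayleigh value and
  hence no smaller. So it is the minimum of the finite set of real eigenvalues.\<close>

lemma lambda_min_hermitian:
  assumes A: "hermitian_mat d A" and d: "d \<ge> 1"
  shows "complex_of_real (lambda_min A) \<in> spectrum A"
    and "lambda_min A * (\<Sum>i<d. (cmod (v i))\<^sup>2) \<le> Re (qform d (entries A) v v)"
proof -
  have cA: "A \<in> carrier_mat d d" using A by (simp add: hermitian_mat_def)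
  obtain l where l: "complex_of_real l \<in> spectrum A"
    and bound: "\<forall>v. l * (\<Sum>i<d. (cmod (v i))\<^sup>2) \<le> Re (qform d (entries A) v v)"
    by (rule hermitian_Rayleigh_minimum[OF A d])
  have "lambda_min A = l"
    unfolding lambda_min_def
  proof (rule Min_eqI)
    show "finite {a. complex_of_real a \<in> spectrum A}"
      using finite_vimageI[OF card_finite_spectrum(1)[OF cA] inj_of_real] by (simp add: vimage_def)
  next
    fix a assume "a \<in> {a. complex_of_real a \<in> spectrum A}"
    then have "complex_of_real a \<in> spectrum A" by simp
    then obtain v where "(\<Sum>i<d. (cmod (v i))\<^sup>2) = 1" "qform d (entries A) v v = of_real a"
      by (rule spectrum_eigenvectorE[OF cA])
    then show "l \<le> a" using bound[rule_format, of v] by simp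
  qed (use l in simp)
  then show "complex_of_real (lambda_min A) \<in> spectrum A"
    and "lambda_min A * (\<Sum>i<d. (cmod (v i))\<^sup>2) \<le> Re (qform d (entries A) v v)"
    using l bound by simp_all
qed

section \<open>Expectation values in mixed and pure states\<close>

lemma expectation_val_eq:
  assumes "\<rho> \<in> carrier_mat d d" "F \<in> carrier_mat d d"
  shows "expectation_val \<rho> F = Re (\<Sum>i<d. \<Sum>j<d. \<rho> $$ (i, j) * F $$ (j, i))"
  using assms
  by (simp add: expectation_val_def mat_trace_def scalar_prod_def atLeast0LessThan)

text \<open>The Gram decomposition exhibits \<rho> as a mixture of \<open>d\<close> unnormalised
  pure states \<open>u l\<close>. Their squared norms are the weights, and they sum to the
  trace.\<close>

lemma density_Gram:
  assumes "\<rho> \<in> density_matrices d"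
  obtains u where "(\<Sum>l<d. \<Sum>i<d. (cmod (u l i))\<^sup>2) = 1"
    and "\<forall>F\<in>carrier_mat d d.
      expectation_val \<rho> F = (\<Sum>l<d. Re (qform d (entries F) (u l) (u l)))"
proof -
  have psd: "psd_mat d \<rho>" and tr: "mat_trace \<rho> = 1" and c\<rho>: "\<rho> \<in> carrier_mat d d"
    using assms by (auto simp: density_matrices_def psd_mat_def hermitian_mat_def)
  obtain u where u: "\<forall>i<d. \<forall>j<d. \<rho> $$ (i, j) = (\<Sum>l<d. u l i * cnj (u l j))"
    by (rule psd_kernel_Gram[OF psd_mat_imp_psd_kernel[OF psd]])
  show thesis
  proof (rule that[of u])
    have "complex_of_real (\<Sum>l<d. \<Sum>i<d. (cmod (u l i))\<^sup>2) = (\<Sum>i<d. \<Sum>l<d. u l i * cnj (u l i))"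
      unfolding of_real_sum complex_norm_square by (rule sum.swap)
    also have "\<dots> = 1" using tr c\<rho> by (simp add: mat_trace_def u)
    finally show "(\<Sum>l<d. \<Sum>i<d. (cmod (u l i))\<^sup>2) = 1" by (simp only: of_real_eq_1_iff)
    show "\<forall>F\<in>carrier_mat d d. expectation_val \<rho> F = (\<Sum>l<d. Re (qform d (entries F) (u l) (u l)))"
    proof
      fix F :: "complex mat" assume F: "F \<in> carrier_mat d d"
      have "(\<Sum>i<d. \<Sum>j<d. \<rho> $$ (i, j) * F $$ (j, i))
          = (\<Sum>i<d. \<Sum>j<d. \<Sum>l<d. F $$ (j, i) * u l i * cnj (u l j))"
        by (intro sum.cong refl) (simp add: u sum_distrib_left mult_ac)
      also have "\<dots> = (\<Sum>j<d. \<Sum>i<d. \<Sum>l<d. F $$ (j, i) * u l i * cnj (u l j))"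
        by (rule sum.swap)
      also have "\<dots> = (\<Sum>j<d. \<Sum>l<d. \<Sum>i<d. F $$ (j, i) * u l i * cnj (u l j))"
        by (rule sum.cong[OF refl], rule sum.swap)
      also have "\<dots> = (\<Sum>l<d. qform d (entries F) (u l) (u l))"
        unfolding qform_def by (rule sum.swap)
      finally show "expectation_val \<rho> F = (\<Sum>l<d. Re (qform d (entries F) (u l) (u l)))"
        by (simp add: expectation_val_eq[OF c\<rho> F])
    qed
  qed
qed

text \<open>The Rayleigh bound is applied to each pure component; the weights sum to 1.\<close>

lemma lambda_min_le_expectation_val:
  assumes F: "hermitian_mat d F" and "d \<ge> 1" and "\<rho> \<in> density_matrices d"
  shows "lambda_min F \<le> expectation_val \<rho> F"
proof -
  obtain u where u: "(\<Sum>l<d. \<Sum>i<d. (cmod (u l i))\<^sup>2) = 1"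
    and ex: "\<forall>F\<in>carrier_mat d d.
      expectation_val \<rho> F = (\<Sum>l<d. Re (qform d (entries F) (u l) (u l)))"
    by (rule density_Gram[OF assms(3)])
  have cF: "F \<in> carrier_mat d d" using F by (simp add: hermitian_mat_def)
  have "lambda_min F = (\<Sum>l<d. lambda_min F * (\<Sum>i<d. (cmod (u l i))\<^sup>2))"
    unfolding sum_distrib_left[symmetric] u by simp
  also have "\<dots> \<le> expectation_val \<rho> F"
    unfolding ex[rule_format, OF cF] by (intro sum_mono lambda_min_hermitian(2)[OF assms(1,2)])
  finally show ?thesis .
qed

text \<open>The witness is the projection onto a unit eigenvector for the least eigenvalue.\<close>

lemma lambda_min_attained:
  assumes F: "hermitian_mat d F" and "d \<ge> 1"
  obtains \<rho> where "\<rho> \<in> density_matrices d" "expectation_val \<rho> F = lambda_min F"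
proof -
  have cF: "F \<in> carrier_mat d d" using F by (simp add: hermitian_mat_def)
  obtain v where v: "(\<Sum>i<d. (cmod (v i))\<^sup>2) = 1" "qform d (entries F) v v = of_real (lambda_min F)"
    by (rule spectrum_eigenvectorE[OF cF lambda_min_hermitian(1)[OF assms]])
  define \<rho> where "\<rho> = Matrix.mat d d (\<lambda>(i, j). v i * cnj (v j))"
  have c\<rho>: "\<rho> \<in> carrier_mat d d" by (simp add: \<rho>_def)
  have "0 \<le> (\<rho> *\<^sub>v w) \<bullet>c w" if w: "w \<in> carrier_vec d" for w
  proof -
    have "(\<rho> *\<^sub>v w) \<bullet>c w = qform d (\<lambda>i j. v i * cnj (v j)) (vec_index w) (vec_index w)"
      unfolding qform_eq_cscalar_prod[OF c\<rho> w w, symmetric]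
      by (intro qform_cong) (simp_all add: \<rho>_def)
    then show ?thesis by (simp add: qform_rank_one less_eq_complex_def)
  qed
  moreover have "hermitian_mat d \<rho>"
    unfolding hermitian_mat_iff by (simp add: \<rho>_def)
  moreover have "mat_trace \<rho> = of_real (\<Sum>i<d. (cmod (v i))\<^sup>2)"
    unfolding of_real_sum complex_norm_square by (simp add: mat_trace_def \<rho>_def)
  ultimately have "\<rho> \<in> density_matrices d"
    by (simp add: density_matrices_def psd_mat_def v)
  moreover have "(\<Sum>i<d. \<Sum>j<d. \<rho> $$ (i, j) * F $$ (j, i)) = qform d (entries F) v v"
    unfolding qform_def by (subst sum.swap) (simp add: \<rho>_def mult_ac)
  then have "expectation_val \<rho> F = lambda_min F"
    by (simp add: expectation_val_eq[OF c\<rho> cF] v)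
  ultimately show thesis by (rule that)
qed

section \<open>Shifted squares and their expectations\<close>

lemma hermitian_mat_add:
  assumes "hermitian_mat d A" "hermitian_mat d B"
  shows "hermitian_mat d (A + B)"
  unfolding hermitian_mat_iff
proof (intro conjI allI impI)
  have carrier: "A \<in> carrier_mat d d" "B \<in> carrier_mat d d"
    using assms by (simp_all add: hermitian_mat_def)
  then show "A + B \<in> carrier_mat d d" by simp
  fix i j assume ij: "i < d" "j < d"
  then have "A $$ (j, i) = cnj (A $$ (i, j))" "B $$ (j, i) = cnj (B $$ (i, j))"
    using assms unfolding hermitian_mat_iff by blast+
  then have "A $$ (j, i) + B $$ (j, i) = cnj (A $$ (i, j) + B $$ (i, j))"
    by (simp only: complex_cnj_add)
  then show "(A + B) $$ (j, i) = cnj ((A + B) $$ (i, j))" using carrier ij by simp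
qed

lemma hermitian_mat_smult_of_real:
  assumes "hermitian_mat d A"
  shows "hermitian_mat d (complex_of_real c \<cdot>\<^sub>m A)"
  unfolding hermitian_mat_iff
proof (intro conjI allI impI)
  have carrier: "A \<in> carrier_mat d d" using assms by (simp add: hermitian_mat_def)
  then show "complex_of_real c \<cdot>\<^sub>m A \<in> carrier_mat d d" by simp
  fix i j assume ij: "i < d" "j < d"
  then have "A $$ (j, i) = cnj (A $$ (i, j))"
    using assms unfolding hermitian_mat_iff by blast
  then have "of_real c * A $$ (j, i) = cnj (of_real c * A $$ (i, j))"
    by (simp only: complex_cnj_mult complex_cnj_complex_of_real)
  then show "(complex_of_real c \<cdot>\<^sub>m A) $$ (j, i) = cnj ((complex_of_real c \<cdot>\<^sub>m A) $$ (i, j))"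
    using carrier ij by simp
qed

lemma hermitian_mat_one: "hermitian_mat d (1\<^sub>m d)"
  unfolding hermitian_mat_iff by auto

lemma pow_mat_2: "A \<in> carrier_mat d d \<Longrightarrow> A ^\<^sub>m 2 = A * A"
  by (simp add: numeral_2_eq_2)

lemma hermitian_mat_square:
  assumes "hermitian_mat d A"
  shows "hermitian_mat d (A ^\<^sub>m 2)"
proof -
  have A: "A \<in> carrier_mat d d" using assms by (simp add: hermitian_mat_def)
  have herm: "\<forall>i<d. \<forall>j<d. A $$ (j, i) = cnj (A $$ (i, j))"
    using assms unfolding hermitian_mat_iff by (rule conjunct2)
  have "(A * A) $$ (j, i) = cnj ((A * A) $$ (i, j))" if ij: "i < d" "j < d" for i j
  proof -
    have "(A * A) $$ (j, i) = (\<Sum>k<d. A $$ (j, k) * A $$ (k, i))"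
      using A ij by (simp add: scalar_prod_def atLeast0LessThan)
    also have "\<dots> = (\<Sum>k<d. cnj (A $$ (i, k) * A $$ (k, j)))"
      by (intro sum.cong refl)
        (metis (no_types, lifting) herm ij complex_cnj_mult lessThan_iff mult.commute)
    also have "\<dots> = cnj ((A * A) $$ (i, j))"
      using A ij by (simp add: scalar_prod_def atLeast0LessThan)
    finally show ?thesis .
  qed
  then show ?thesis
    using A unfolding hermitian_mat_iff pow_mat_2[OF A] by (metis mult_carrier_mat)
qed

text \<open>Without subtraction, closure and linearity under sums and real multiples suffice in what
  follows.\<close>

lemma shifted_square_eq:
  assumes "X \<in> carrier_mat d d"
  shows "shifted_square X a b = X ^\<^sub>m 2 + complex_of_real (- (a + b)) \<cdot>\<^sub>m X
    + complex_of_real (a * b) \<cdot>\<^sub>m 1\<^sub>m d"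
  using assms pow_carrier_mat[OF assms, of 2]
  by (intro eq_matI) (simp_all add: shifted_square_def algebra_simps)

lemma hermitian_mat_shifted_square:
  assumes "hermitian_mat d X"
  shows "hermitian_mat d (shifted_square X a b)"
proof -
  have X: "X \<in> carrier_mat d d" using assms by (simp add: hermitian_mat_def)
  show ?thesis
    unfolding shifted_square_eq[OF X]
    by (intro assms hermitian_mat_add hermitian_mat_smult_of_real hermitian_mat_one hermitian_mat_square)
qed

lemma expectation_val_add:
  assumes "\<rho> \<in> carrier_mat d d" "A \<in> carrier_mat d d" "B \<in> carrier_mat d d"
  shows "expectation_val \<rho> (A + B) = expectation_val \<rho> A + expectation_val \<rho> B"
proof -
  have "A + B \<in> carrier_mat d d" using assms by simp
  moreover have "(\<Sum>i<d. \<Sum>j<d. \<rho> $$ (i, j) * (A + B) $$ (j, i))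
     = (\<Sum>i<d. \<Sum>j<d. \<rho> $$ (i, j) * A $$ (j, i)) + (\<Sum>i<d. \<Sum>j<d. \<rho> $$ (i, j) * B $$ (j, i))"
    unfolding sum.distrib[symmetric] using assms by (simp add: distrib_left)
  ultimately show ?thesis using assms by (simp only: expectation_val_eq plus_complex.sel)
qed

lemma expectation_val_smult:
  assumes "\<rho> \<in> carrier_mat d d" "A \<in> carrier_mat d d"
  shows "expectation_val \<rho> (complex_of_real c \<cdot>\<^sub>m A) = c * expectation_val \<rho> A"
proof -
  have "complex_of_real c \<cdot>\<^sub>m A \<in> carrier_mat d d" using assms by simp
  moreover have "(\<Sum>i<d. \<Sum>j<d. \<rho> $$ (i, j) * (complex_of_real c \<cdot>\<^sub>m A) $$ (j, i))
     = complex_of_real c * (\<Sum>i<d. \<Sum>j<d. \<rho> $$ (i, j) * A $$ (j, i))"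
    unfolding sum_distrib_left using assms by (simp add: mult_ac)
  ultimately show ?thesis using assms by (simp only: expectation_val_eq) simp
qed

lemma density_matrices_carrier: "\<rho> \<in> density_matrices d \<Longrightarrow> \<rho> \<in> carrier_mat d d"
  by (simp add: density_matrices_def psd_mat_def hermitian_mat_def)

lemma expectation_val_one:
  assumes "\<rho> \<in> density_matrices d"
  shows "expectation_val \<rho> (1\<^sub>m d) = 1"
  using assms density_matrices_carrier[OF assms]
  by (simp add: expectation_val_def density_matrices_def)

text \<open>The second moment is the variance plus the squared mean; the rest is factoring. The case
  \<open>a = b\<close> gives the variance plus the squared distance of the mean from
  \<open>a\<close>.\<close>

lemma expectation_val_shifted_square:
  assumes \<rho>: "\<rho> \<in> density_matrices d" and X: "X \<in> carrier_mat d d"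
  shows "expectation_val \<rho> (shifted_square X a b)
    = variance_val \<rho> X + (expectation_val \<rho> X - a) * (expectation_val \<rho> X - b)"
proof -
  note c\<rho> = density_matrices_carrier[OF \<rho>]
  note cX2 = pow_carrier_mat[OF X, of 2]
  have "expectation_val \<rho> (shifted_square X a b)
     = expectation_val \<rho> (X ^\<^sub>m 2 + complex_of_real (- (a + b)) \<cdot>\<^sub>m X)
       + expectation_val \<rho> (complex_of_real (a * b) \<cdot>\<^sub>m 1\<^sub>m d)"
    unfolding shifted_square_eq[OF X]
    by (rule expectation_val_add[OF c\<rho>]) (use X cX2 in simp_all)
  also have "expectation_val \<rho> (X ^\<^sub>m 2 + complex_of_real (- (a + b)) \<cdot>\<^sub>m X)
     = expectation_val \<rho> (X ^\<^sub>m 2) + expectation_val \<rho> (complex_of_real (- (a + b)) \<cdot>\<^sub>m X)"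
    by (rule expectation_val_add[OF c\<rho> cX2]) (use X in simp)
  also have "expectation_val \<rho> (complex_of_real (- (a + b)) \<cdot>\<^sub>m X) = - (a + b) * expectation_val \<rho> X"
    by (rule expectation_val_smult[OF c\<rho> X])
  also have "expectation_val \<rho> (complex_of_real (a * b) \<cdot>\<^sub>m 1\<^sub>m d) = a * b"
    unfolding expectation_val_smult[OF c\<rho> one_carrier_mat] expectation_val_one[OF \<rho>] by simp
  finally show ?thesis by (simp add: variance_val_def power2_eq_square algebra_simps)
qed

text \<open>The bound \<open>u\<close> is minus the least eigenvalue of \<open>-X\<close>, so the
  lower bound for \<open>-X\<close> applies.\<close>

lemma expectation_val_upper:
  assumes X: "hermitian_mat d X" and d: "d \<ge> 1"
  obtains u where "complex_of_real u \<in> spectrum X"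
    and "\<forall>\<rho>\<in>density_matrices d. expectation_val \<rho> X \<le> u"
proof -
  have cX: "X \<in> carrier_mat d d" using X by (simp add: hermitian_mat_def)
  define N where "N = complex_of_real (- 1) \<cdot>\<^sub>m X"
  have N: "hermitian_mat d N" unfolding N_def by (rule hermitian_mat_smult_of_real[OF X])
  have "eigenvalue N (of_real (lambda_min N))"
    using lambda_min_hermitian(1)[OF N d] by (simp add: spectrum_def)
  then obtain v where v: "v \<in> carrier_vec d" "v \<noteq> 0\<^sub>v d" "N *\<^sub>v v = of_real (lambda_min N) \<cdot>\<^sub>v v"
    using cX by (auto simp: eigenvalue_def eigenvector_def N_def)
  have "X *\<^sub>v v = of_real (- 1) \<cdot>\<^sub>v (N *\<^sub>v v)"
    using cX v(1) by (intro eq_vecI) (auto simp: N_def)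
  also have "\<dots> = of_real (- lambda_min N) \<cdot>\<^sub>v v"
    using v by (simp add: smult_smult_assoc)
  finally have "complex_of_real (- lambda_min N) \<in> spectrum X"
    using v cX by (auto simp: spectrum_def eigenvalue_def eigenvector_def)
  moreover have "expectation_val \<rho> X \<le> - lambda_min N" if \<rho>: "\<rho> \<in> density_matrices d" for \<rho>
    using lambda_min_le_expectation_val[OF N d \<rho>]
      expectation_val_smult[OF density_matrices_carrier[OF \<rho>] cX, of "- 1"]
    by (simp add: N_def)
  ultimately show thesis by (intro that[of "- lambda_min N"]) blast+
qed

section \<open>Existence of a state of minimal total variance\<close>

text \<open>For a fixed state, the total variance is the least expectation of \<open>H p\<close>
  over all \<open>p\<close>, reached when \<open>p\<close> is the pair of means. Minimising over
  states thus reduces to minimising \<open>h\<close> over a box in the plane.\<close>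

lemma min_variance_sum_exists:
  assumes d: "d \<ge> 1" and X: "hermitian_mat d X" and Y: "hermitian_mat d Y"
  obtains \<rho>\<^sub>0 where "is_arg_min (\<lambda>\<rho>. variance_val \<rho> X + variance_val \<rho> Y)
    (\<lambda>\<rho>. \<rho> \<in> density_matrices d) \<rho>\<^sub>0"
proof -
  have cX: "X \<in> carrier_mat d d" and cY: "Y \<in> carrier_mat d d"
    using X Y by (simp_all add: hermitian_mat_def)
  define H where "H p = shifted_square X (fst p) (fst p) + shifted_square Y (snd p) (snd p)"
    for p :: "real \<times> real"
  define V where "V \<rho> = variance_val \<rho> X + variance_val \<rho> Y" for \<rho>
  have H: "hermitian_mat d (H p)" for p
    unfolding H_def by (intro hermitian_mat_add hermitian_mat_shifted_square X Y)
  have EH: "expectation_val \<rho> (H p)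
      = V \<rho> + (expectation_val \<rho> X - fst p)\<^sup>2 + (expectation_val \<rho> Y - snd p)\<^sup>2"
    if "\<rho> \<in> density_matrices d" for \<rho> p
    using hermitian_mat_shifted_square[OF X, of "fst p" "fst p"]
      hermitian_mat_shifted_square[OF Y, of "snd p" "snd p"]
    by (simp add: H_def V_def hermitian_mat_def expectation_val_add[OF density_matrices_carrier[OF that]]
        expectation_val_shifted_square[OF that] cX cY power2_eq_square)
  define h where "h p = lambda_min (H p)" for p
  have h_le: "h p \<le> expectation_val \<rho> (H p)" if "\<rho> \<in> density_matrices d" for \<rho> p
    unfolding h_def by (rule lambda_min_le_expectation_val[OF H d that])
  have "convex_on UNIV (\<lambda>p. (fst p)\<^sup>2 + (snd p)\<^sup>2 - h p)"
  proof (rule convex_onI)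
    fix t :: real and p q :: "real \<times> real"
    assume t: "0 < t" "t < 1"
    define r where "r = (1 - t) *\<^sub>R p + t *\<^sub>R q"
    \<comment> \<open>The function \<open>aff\<close> of a state optimal at \<open>r\<close> is
      affine, since the squares of the coordinates cancel. It agrees with the function in question
      at \<open>r\<close> and lies below it everywhere, so it supports it at
      \<open>r\<close>.\<close>
    obtain \<rho> where \<rho>: "\<rho> \<in> density_matrices d" and eq: "expectation_val \<rho> (H r) = h r"
      unfolding h_def by (rule lambda_min_attained[OF H d])
    define aff where "aff s = (fst s)\<^sup>2 + (snd s)\<^sup>2 - expectation_val \<rho> (H s)" for s
    have aff: "aff s = 2 * expectation_val \<rho> X * fst s + 2 * expectation_val \<rho> Y * snd s - aff0"
      if "aff0 = V \<rho> + (expectation_val \<rho> X)\<^sup>2 + (expectation_val \<rho> Y)\<^sup>2" for s aff0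
      by (simp add: aff_def EH[OF \<rho>] that power2_eq_square algebra_simps)
    have "(fst r)\<^sup>2 + (snd r)\<^sup>2 - h r = aff r" by (simp add: aff_def eq)
    also have "\<dots> = (1 - t) * aff p + t * aff q"
      unfolding aff[OF refl] by (simp add: r_def algebra_simps)
    also have "\<dots> \<le> (1 - t) * ((fst p)\<^sup>2 + (snd p)\<^sup>2 - h p) + t * ((fst q)\<^sup>2 + (snd q)\<^sup>2 - h q)"
      using t h_le[OF \<rho>] by (intro add_mono mult_left_mono) (simp_all add: aff_def)
    finally show "(fst r)\<^sup>2 + (snd r)\<^sup>2 - h r
      \<le> (1 - t) * ((fst p)\<^sup>2 + (snd p)\<^sup>2 - h p) + t * ((fst q)\<^sup>2 + (snd q)\<^sup>2 - h q)" .
  qed simp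
  then have "continuous_on UNIV (\<lambda>p. (fst p)\<^sup>2 + (snd p)\<^sup>2 - h p)" (is "continuous_on _ ?k")
    by (rule convex_on_continuous[OF open_UNIV])
  moreover have "continuous_on UNIV (\<lambda>p :: real \<times> real. (fst p)\<^sup>2 + (snd p)\<^sup>2)"
    by (intro continuous_intros)
  ultimately have "continuous_on UNIV (\<lambda>p. ((fst p)\<^sup>2 + (snd p)\<^sup>2) - ?k p)"
    by (rule continuous_on_diff[rotated])
  then have cont: "continuous_on UNIV h" by simp
  obtain ux where ux: "\<forall>\<rho>\<in>density_matrices d. expectation_val \<rho> X \<le> ux"
    by (rule expectation_val_upper[OF X d])
  obtain uy where uy: "\<forall>\<rho>\<in>density_matrices d. expectation_val \<rho> Y \<le> uy"
    by (rule expectation_val_upper[OF Y d])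
  \<comment> \<open>A compact box containing the pair of means of every state.\<close>
  define K where "K = {lambda_min X..ux} \<times> {lambda_min Y..uy}"
  have inK: "(expectation_val \<rho> X, expectation_val \<rho> Y) \<in> K" if "\<rho> \<in> density_matrices d" for \<rho>
    using lambda_min_le_expectation_val[OF X d that] lambda_min_le_expectation_val[OF Y d that]
      ux uy that by (simp add: K_def)
  obtain \<rho>' where "\<rho>' \<in> density_matrices d" by (rule lambda_min_attained[OF X d])
  then have "K \<noteq> {}" using inK by blast
  moreover have "compact K" unfolding K_def by (intro compact_Times compact_Icc)
  ultimately have "\<exists>p\<in>K. \<forall>q\<in>K. h p \<le> h q"
    by (intro continuous_attains_inf continuous_on_subset[OF cont subset_UNIV])
  then obtain p where p: "\<forall>q\<in>K. h p \<le> h q" ..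
  \<comment> \<open>The minimiser is a ground state at the best \<open>p\<close>. Dropping the two
    squares bounds its total variance by \<open>h p\<close>, and \<open>h p\<close> is at most
    \<open>h\<close> at the means of any competitor.\<close>
  obtain \<rho>\<^sub>0 where \<rho>\<^sub>0: "\<rho>\<^sub>0 \<in> density_matrices d" and eq: "expectation_val \<rho>\<^sub>0 (H p) = h p"
    unfolding h_def by (rule lambda_min_attained[OF H d])
  have "V \<rho>\<^sub>0 \<le> V \<rho>" if \<rho>: "\<rho> \<in> density_matrices d" for \<rho>
  proof -
    have "V \<rho>\<^sub>0 \<le> expectation_val \<rho>\<^sub>0 (H p)" by (simp add: EH[OF \<rho>\<^sub>0])
    also have "\<dots> \<le> h (expectation_val \<rho> X, expectation_val \<rho> Y)"
      using p inK[OF \<rho>] eq by simp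
    also have "\<dots> \<le> expectation_val \<rho> (H (expectation_val \<rho> X, expectation_val \<rho> Y))"
      by (rule h_le[OF \<rho>])
    also have "\<dots> = V \<rho>" by (simp add: EH[OF \<rho>])
    finally show ?thesis .
  qed
  then show thesis using \<rho>\<^sub>0 by (intro that[of \<rho>\<^sub>0]) (simp add: is_arg_min_linorder V_def)
qed

section \<open>Consecutive levels and gaps\<close>

text \<open>Induction on the number of levels: \<mu> is at most the last level but one, or it lies
  in the last interval.\<close>

lemma consecutive_levels_around:
  fixes x :: "nat \<Rightarrow> 'a :: linorder" and n :: nat
  assumes "n \<ge> 2" "x 1 \<le> \<mu>" "\<mu> \<le> x n"
  obtains i where "i \<in> {1..n - 1}" "x i \<le> \<mu>" "\<mu> \<le> x (i + 1)"
proof -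
  have "\<exists>i\<in>{1..n - 1}. x i \<le> \<mu> \<and> \<mu> \<le> x (i + 1)"
    using assms
  proof (induction n rule: dec_induct)
    case base
    then show ?case by (simp add: numeral_2_eq_2)
  next
    case (step k)
    show ?case
    proof (cases "\<mu> \<le> x k")
      case True
      then obtain i where "i \<in> {1..k - 1}" "x i \<le> \<mu> \<and> \<mu> \<le> x (i + 1)"
        using step by blast
      then show ?thesis by (intro bexI[of _ i]) auto
    next
      case False
      then show ?thesis using step by (intro bexI[of _ k]) auto
    qed
  qed
  then show thesis using that by blast
qed

text \<open>The mean lies between two eigenvalues, and every eigenvalue is a level between
  \<open>x 1\<close> and \<open>x n\<close>.\<close>

lemma expectation_val_consecutive_levels:
  fixes x :: "nat \<Rightarrow> real"
  assumes X: "hermitian_mat d X" and d: "d \<ge> 1" and n: "n \<ge> 2" and mono: "strict_mono_on {1..n} x"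
    and spec: "spectrum X \<subseteq> (\<lambda>i. complex_of_real (x i)) ` {1..n}"
    and \<rho>: "\<rho> \<in> density_matrices d"
  obtains i where "i \<in> {1..n - 1}" "x i \<le> expectation_val \<rho> X" "expectation_val \<rho> X \<le> x (i + 1)"
proof (rule consecutive_levels_around[OF n])
  have range: "x 1 \<le> k \<and> k \<le> x n" if k: "complex_of_real k \<in> spectrum X" for k
  proof -
    obtain i where i: "i \<in> {1..n}" "k = x i" using spec k by auto
    then show ?thesis
      using strict_mono_on_leD[OF mono, of 1 i] strict_mono_on_leD[OF mono, of i n] by auto
  qed
  show "x 1 \<le> expectation_val \<rho> X"
    using range[OF lambda_min_hermitian(1)[OF X d]] lambda_min_le_expectation_val[OF X d \<rho>] by simp
  obtain u where u: "complex_of_real u \<in> spectrum X"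
    "\<forall>\<rho>\<in>density_matrices d. expectation_val \<rho> X \<le> u"
    by (rule expectation_val_upper[OF X d])
  then show "expectation_val \<rho> X \<le> x n" using range[OF u(1)] \<rho> by force
qed (rule that)

lemma half_gap_square_le_gap_error:
  assumes mono: "strict_mono_on {1..n} x" and i: "i \<in> {1..n - 1}"
  shows "((x (i + 1) - x i) / 2)\<^sup>2 \<le> gap_error x n"
proof -
  have "x (i + 1) - x i \<le> Max ((\<lambda>i. x (i + 1) - x i) ` {1..n - 1})"
    using i by (intro Max_ge) auto
  moreover have "x i < x (i + 1)" using i by (intro strict_mono_onD[OF mono]) auto
  ultimately show ?thesis unfolding gap_error_def by (intro power_mono) auto
qed

text \<open>Completing the square about the midpoint of \<open>a\<close> and \<open>b\<close>, where
  equality holds.\<close>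

lemma minus_prod_le_half_gap_square: "- ((\<mu> - a) * (\<mu> - b)) \<le> ((b - a) / 2)\<^sup>2" for \<mu> a b :: real
proof -
  have "((b - a) / 2)\<^sup>2 + (\<mu> - a) * (\<mu> - b) = (\<mu> - (a + b) / 2)\<^sup>2"
    by (simp add: power2_eq_square field_simps)
  then show ?thesis using zero_le_power2[of "\<mu> - (a + b) / 2"] by linarith
qed

section \<open>The spectral bound and its error\<close>

theorem proposition1:
  fixes d n m :: nat and X Y :: "complex mat" and x y :: "nat \<Rightarrow> real"
  assumes "d \<ge> 1"
    and "hermitian_mat d X" and "hermitian_mat d Y"
    and "n \<ge> 2" and "m \<ge> 2"
    and "strict_mono_on {1..n} x" and "strict_mono_on {1..m} y"
    and "spectrum X \<subseteq> (\<lambda>i. complex_of_real (x i)) ` {1..n}"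
    and "spectrum Y \<subseteq> (\<lambda>j. complex_of_real (y j)) ` {1..m}"
  shows "(\<forall>\<rho>\<in>density_matrices d.
            variance_val \<rho> X + variance_val \<rho> Y \<ge> spectral_bound X x n Y y m) \<and>
         (\<exists>\<rho>\<^sub>0. is_arg_min (\<lambda>\<rho>. variance_val \<rho> X + variance_val \<rho> Y)
                  (\<lambda>\<rho>. \<rho> \<in> density_matrices d) \<rho>\<^sub>0 \<and>
               (variance_val \<rho>\<^sub>0 X + variance_val \<rho>\<^sub>0 Y) - spectral_bound X x n Y y m
                 \<le> gap_error x n + gap_error y m)"
proof
  define H where "H i j = shifted_square X (x i) (x (i + 1)) + shifted_square Y (y j) (y (j + 1))" for i j
  define L where "L = {lambda_min (H i j) | i j. i \<in> {1..n - 1} \<and> j \<in> {1..m - 1}}"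
  have bound_eq: "spectral_bound X x n Y y m = Min L"
    unfolding spectral_bound_def L_def H_def ..
  \<comment> \<open>As an image of a finite product, nonempty since \<open>n\<close> and
    \<open>m\<close> are at least 2, \<open>L\<close> has a genuine minimum.\<close>
  have L_image: "L = (\<lambda>(i, j). lambda_min (H i j)) ` ({1..n - 1} \<times> {1..m - 1})"
  proof (intro equalityI subsetI)
    fix z assume "z \<in> (\<lambda>(i, j). lambda_min (H i j)) ` ({1..n - 1} \<times> {1..m - 1})"
    then obtain i j where "z = lambda_min (H i j)" "i \<in> {1..n - 1} \<and> j \<in> {1..m - 1}" by auto
    then show "z \<in> L" unfolding L_def by blast
  qed (auto simp: L_def)
  have L: "finite L" "L \<noteq> {}" using assms(4,5) by (auto simp: L_image)
  have herm: "hermitian_mat d (H i j)" for i j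
    unfolding H_def by (intro hermitian_mat_add hermitian_mat_shifted_square assms(2,3))
  have EH: "expectation_val \<rho> (H i j) = variance_val \<rho> X + variance_val \<rho> Y
      + (expectation_val \<rho> X - x i) * (expectation_val \<rho> X - x (i + 1))
      + (expectation_val \<rho> Y - y j) * (expectation_val \<rho> Y - y (j + 1))"
    if "\<rho> \<in> density_matrices d" for \<rho> i j
    using hermitian_mat_shifted_square[OF assms(2), of "x i" "x (i + 1)"]
      hermitian_mat_shifted_square[OF assms(3), of "y j" "y (j + 1)"] assms(2,3)
    by (simp add: H_def hermitian_mat_def expectation_val_add[OF density_matrices_carrier[OF that]]
        expectation_val_shifted_square[OF that])
  show "\<forall>\<rho>\<in>density_matrices d. variance_val \<rho> X + variance_val \<rho> Y \<ge> spectral_bound X x n Y y m"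
  proof
    fix \<rho> assume \<rho>: "\<rho> \<in> density_matrices d"
    \<comment> \<open>With the means enclosed by consecutive levels, both products in
      \<open>EH\<close> are nonpositive.\<close>
    obtain i where i: "i \<in> {1..n - 1}" "x i \<le> expectation_val \<rho> X" "expectation_val \<rho> X \<le> x (i + 1)"
      by (rule expectation_val_consecutive_levels[OF assms(2,1,4,6,8) \<rho>])
    obtain j where j: "j \<in> {1..m - 1}" "y j \<le> expectation_val \<rho> Y" "expectation_val \<rho> Y \<le> y (j + 1)"
      by (rule expectation_val_consecutive_levels[OF assms(3,1,5,7,9) \<rho>])
    have "spectral_bound X x n Y y m \<le> lambda_min (H i j)"
      unfolding bound_eq using L(1) i(1) j(1) by (intro Min_le) (auto simp: L_image)
    also have "\<dots> \<le> expectation_val \<rho> (H i j)"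
      by (rule lambda_min_le_expectation_val[OF herm assms(1) \<rho>])
    also have "\<dots> \<le> variance_val \<rho> X + variance_val \<rho> Y"
      using mult_nonneg_nonpos[of "expectation_val \<rho> X - x i" "expectation_val \<rho> X - x (i + 1)"]
        mult_nonneg_nonpos[of "expectation_val \<rho> Y - y j" "expectation_val \<rho> Y - y (j + 1)"] i j
      by (simp add: EH[OF \<rho>])
    finally show "spectral_bound X x n Y y m \<le> variance_val \<rho> X + variance_val \<rho> Y" .
  qed
  have "Min L \<in> L" by (rule Min_in[OF L])
  then obtain i j where ij: "i \<in> {1..n - 1}" "j \<in> {1..m - 1}" "Min L = lambda_min (H i j)"
    by (auto simp: L_image)
  \<comment> \<open>This ground state of the best pair need not minimise the total variance; it only
    bounds the minimum from above.\<close>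
  obtain \<rho> where \<rho>: "\<rho> \<in> density_matrices d" "expectation_val \<rho> (H i j) = lambda_min (H i j)"
    by (rule lambda_min_attained[OF herm assms(1)])
  obtain \<rho>\<^sub>0 where \<rho>\<^sub>0: "is_arg_min (\<lambda>\<rho>. variance_val \<rho> X + variance_val \<rho> Y)
      (\<lambda>\<rho>. \<rho> \<in> density_matrices d) \<rho>\<^sub>0"
    by (rule min_variance_sum_exists[OF assms(1-3)])
  have "variance_val \<rho>\<^sub>0 X + variance_val \<rho>\<^sub>0 Y \<le> variance_val \<rho> X + variance_val \<rho> Y"
    using \<rho>\<^sub>0 \<rho>(1) by (simp add: is_arg_min_linorder)
  also have "\<dots> \<le> lambda_min (H i j) + ((x (i + 1) - x i) / 2)\<^sup>2 + ((y (j + 1) - y j) / 2)\<^sup>2"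
    using EH[OF \<rho>(1), of i j] \<rho>(2)
      minus_prod_le_half_gap_square[of "expectation_val \<rho> X" "x i" "x (i + 1)"]
      minus_prod_le_half_gap_square[of "expectation_val \<rho> Y" "y j" "y (j + 1)"]
    by linarith
  also have "\<dots> \<le> lambda_min (H i j) + gap_error x n + gap_error y m"
    by (intro add_mono order_refl half_gap_square_le_gap_error assms(6,7) ij)
  finally show "\<exists>\<rho>\<^sub>0. is_arg_min (\<lambda>\<rho>. variance_val \<rho> X + variance_val \<rho> Y)
      (\<lambda>\<rho>. \<rho> \<in> density_matrices d) \<rho>\<^sub>0 \<and>
      (variance_val \<rho>\<^sub>0 X + variance_val \<rho>\<^sub>0 Y) - spectral_bound X x n Y y m
        \<le> gap_error x n + gap_error y m"
    using \<rho>\<^sub>0 by (intro exI[of _ \<rho>\<^sub>0]) (simp add: bound_eq ij(3))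
qed

end
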